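(* Let $(V,b,c,m)$ be a weighted graph, $x_0\in V$, and let $(V^{\mathrm{sym}},b^{\mathrm{sym}},c^{\mathrm{sym}},m^{\mathrm{sym}})$ be a weakly spherically symmetric graph. (1) If $(V,b,c,m)$ has stronger curvature growth and weaker potential with respect to $x_0$ than $(V^{\mathrm{sym}},b^{\mathrm{sym}},c^{\mathrm{sym}},m^{\mathrm{sym}})$, and the latter is stochastically incomplete at infinity, then $(V,b,c,m)$ is stochastically incomplete at infinity. (2) If $(V,b,c,m)$ has weaker curvature growth and stronger potential with respect to $x_0$ than $(V^{\mathrm{sym}},b^{\mathrm{sym}},c^{\mathrm{sym}},m^{\mathrm{sym}})$, and the latter is stochastically complete at infinity, then $(V,b,c,m)$ is stochastically complete at infinity.
   Context: A weighted graph $(V,b,c,m)$ consists of a countably infinite set $V$, a map $m:V\to(0,\infty)$, a symmetric map $b:V\times V\to[0,\infty)$ with zero diagonal, and a map $c:V\to[0,\infty)$. Write $x\sim y$ if $b(x,y)>0$. All weighted graphs are assumed connected (any two vertices are joined by a finite path of successive neighbors) and locally finite (each vertex has only finitely many neighbors). Let $d$ be the combinatorial graph metric. For a fixed vertex $x_0$ and $r\in\mathbb{N}_0=\{0,1,2,\dots\}$ put $S_r(x_0)=\{x:d(x,x_0)=r\}$, $S_{-1}=\emptyset$. For $x\in S_r(x_0)$ let $\kappa_{\pm}(x)=\frac1{m(x)}\sum_{y\in S_{r\pm1}(x_0)}b(x,y)$, and let $q=c/m$. The graph is weakly spherically symmetric with root $o$ if $\kappa_\pm$ (computed with respect to $o$)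 and $q$ depend only on $d(\cdot,o)$; then write $\kappa_\pm^{\mathrm{sym}}(r)$, $q^{\mathrm{sym}}(r)$ for the values on $S_r(o)$. $(V,b,c,m)$ has stronger (respectively, weaker) curvature growth with respect to $x_0\in V$ than a weakly spherically symmetric graph with root $o$ if $m(x_0)=m^{\mathrm{sym}}(o)$ and, for all $r\in\mathbb{N}_0$ and $x\in S_r(x_0)\subset V$, $\kappa_+(x)\ge\kappa_+^{\mathrm{sym}}(r)$ and $\kappa_-(x)\le\kappa_-^{\mathrm{sym}}(r)$ (respectively, $\kappa_+(x)\le\kappa_+^{\mathrm{sym}}(r)$ and $\kappa_-(x)\ge\kappa_-^{\mathrm{sym}}(r)$). It has stronger (respectively, weaker) potential with respect to $x_0$ if for all $r\in\mathbb{N}_0$ and $x\in S_r(x_0)$, $q(x)\ge q^{\mathrm{sym}}(r)$ (respectively, $q(x)\le q^{\mathrm{sym}}(r)$). The formal Laplacian is $\widetilde Lf(x)=\frac1{m(x)}\sum_{y}b(x,y)(f(x)-f(y))+\frac{c(x)}{m(x)}f(x)$ for $f:V\to\mathbb{R}$. A solution of the heat equation with initial condition $u_0$ is $u:V\times[0,\infty)\to\mathbb{R}$ such that for all $x$, $u(x,\cdot)$ is continuous on $[0,\infty)$, differentiable on $(0,\infty)$, $(\widetilde L+\frac{d}{dt})u(x,t)=0$ for $t>0$, and $u(x,0)=u_0(x)$. It is a known result that the following are equivalent: (i) there is a non-zero bounded $v:V\to[0,\infty)$ with $(\widetilde L+\alpha)v\le0$ for some (equivalently, all) $\alpha>0$;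 (ii) there is a bounded $v:V\to(0,\infty)$ with $(\widetilde L+\alpha)v=0$ for some (equivalently, all) $\alpha>0$; (iii) there is a non-trivial bounded solution of the heat equation with initial condition $u_0\equiv0$. The graph is called stochastically incomplete at infinity if these equivalent statements hold, and stochastically complete at infinity otherwise. *)

theory Defs
  imports "HOL-Analysis.Analysis"
begin

record 'v wgraph =
  verts :: "'v set"
  edge_weight :: "'v \<Rightarrow> 'v \<Rightarrow> real"
  pot :: "'v \<Rightarrow> real"
  meas :: "'v \<Rightarrow> real"

definition nbrs :: "'v wgraph \<Rightarrow> 'v \<Rightarrow> 'v set" where
  "nbrs G x = {y \<in> verts G. edge_weight G x y > 0}"

definition adj_rel :: "'v wgraph \<Rightarrow> 'v rel" where
  "adj_rel G = {(x, y). x \<in> verts G \<and> y \<in> nbrs G x}"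

text \<open>Weighted graphs are understood to be connected and locally finite. The three weight
  functions are constrained only on the vertex set.\<close>

locale weighted_graph =
  fixes G :: "'v wgraph"
  assumes countable_verts: "countable (verts G)"
    and infinite_verts: "infinite (verts G)"
    and meas_pos: "x \<in> verts G \<Longrightarrow> meas G x > 0"
    and edge_weight_nonneg: "x \<in> verts G \<Longrightarrow> y \<in> verts G \<Longrightarrow> edge_weight G x y \<ge> 0"
    and edge_weight_sym: "x \<in> verts G \<Longrightarrow> y \<in> verts G \<Longrightarrow> edge_weight G x y = edge_weight G y x"
    and edge_weight_diag: "x \<in> verts G \<Longrightarrow> edge_weight G x x = 0"
    and pot_nonneg: "x \<in> verts G \<Longrightarrow> pot G x \<ge> 0"
    and connected: "x \<in> verts G \<Longrightarrow> y \<in> verts G \<Longrightarrow> (x, y) \<in> (adj_rel G)\<^sup>*"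
    and locally_finite: "x \<in> verts G \<Longrightarrow> finite (nbrs G x)"

definition gdist :: "'v wgraph \<Rightarrow> 'v \<Rightarrow> 'v \<Rightarrow> nat" where
  "gdist G x y = (LEAST n. (x, y) \<in> adj_rel G ^^ n)"

text \<open>The radius is an integer, so that the sphere of radius \<open>-1\<close> is empty. In a weighted graph
  all spheres are finite (by connectedness and local finiteness), so the sums in
  \<open>kappa_plus\<close> and \<open>kappa_minus\<close> below are genuine finite sums.\<close>

definition gsphere :: "'v wgraph \<Rightarrow> 'v \<Rightarrow> int \<Rightarrow> 'v set" where
  "gsphere G x0 r = {x \<in> verts G. int (gdist G x x0) = r}"

definition kappa_plus :: "'v wgraph \<Rightarrow> 'v \<Rightarrow> 'v \<Rightarrow> real" where
  "kappa_plus G x0 x =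
     1 / meas G x * (\<Sum>y\<in>gsphere G x0 (int (gdist G x x0) + 1). edge_weight G x y)"

definition kappa_minus :: "'v wgraph \<Rightarrow> 'v \<Rightarrow> 'v \<Rightarrow> real" where
  "kappa_minus G x0 x =
     1 / meas G x * (\<Sum>y\<in>gsphere G x0 (int (gdist G x x0) - 1). edge_weight G x y)"

definition qpot :: "'v wgraph \<Rightarrow> 'v \<Rightarrow> real" where
  "qpot G x = pot G x / meas G x"

definition radial :: "'v wgraph \<Rightarrow> 'v \<Rightarrow> ('v \<Rightarrow> real) \<Rightarrow> bool" where
  "radial G x0 f \<longleftrightarrow>
     (\<forall>x\<in>verts G. \<forall>y\<in>verts G. gdist G x x0 = gdist G y x0 \<longrightarrow> f x = f y)"

definition weakly_spherically_symmetric :: "'v wgraph \<Rightarrow> 'v \<Rightarrow> bool" where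
  "weakly_spherically_symmetric G x0 \<longleftrightarrow> weighted_graph G \<and> x0 \<in> verts G \<and>
     radial G x0 (kappa_plus G x0) \<and> radial G x0 (kappa_minus G x0) \<and> radial G x0 (qpot G)"

text \<open>The common value of a radial function on the sphere of radius \<open>r\<close>. It is well defined for
  every \<open>r\<close>, since all spheres in an infinite, connected, locally finite graph are nonempty.\<close>

definition radial_value :: "'v wgraph \<Rightarrow> 'v \<Rightarrow> ('v \<Rightarrow> real) \<Rightarrow> nat \<Rightarrow> real" where
  "radial_value G x0 f r = (THE a. a \<in> f ` gsphere G x0 (int r))"

definition kappa_plus_sym :: "'v wgraph \<Rightarrow> 'v \<Rightarrow> nat \<Rightarrow> real" where
  "kappa_plus_sym G x0 = radial_value G x0 (kappa_plus G x0)"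

definition kappa_minus_sym :: "'v wgraph \<Rightarrow> 'v \<Rightarrow> nat \<Rightarrow> real" where
  "kappa_minus_sym G x0 = radial_value G x0 (kappa_minus G x0)"

definition qpot_sym :: "'v wgraph \<Rightarrow> 'v \<Rightarrow> nat \<Rightarrow> real" where
  "qpot_sym G x0 = radial_value G x0 (qpot G)"

definition stronger_curvature_growth ::
  "'v wgraph \<Rightarrow> 'v \<Rightarrow> 'w wgraph \<Rightarrow> 'w \<Rightarrow> bool" where
  "stronger_curvature_growth G x0 H y0 \<longleftrightarrow> meas G x0 = meas H y0 \<and>
     (\<forall>r::nat. \<forall>x\<in>gsphere G x0 (int r).
        kappa_plus G x0 x \<ge> kappa_plus_sym H y0 r \<and>
        kappa_minus G x0 x \<le> kappa_minus_sym H y0 r)"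

definition weaker_curvature_growth ::
  "'v wgraph \<Rightarrow> 'v \<Rightarrow> 'w wgraph \<Rightarrow> 'w \<Rightarrow> bool" where
  "weaker_curvature_growth G x0 H y0 \<longleftrightarrow> meas G x0 = meas H y0 \<and>
     (\<forall>r::nat. \<forall>x\<in>gsphere G x0 (int r).
        kappa_plus G x0 x \<le> kappa_plus_sym H y0 r \<and>
        kappa_minus G x0 x \<ge> kappa_minus_sym H y0 r)"

definition stronger_potential ::
  "'v wgraph \<Rightarrow> 'v \<Rightarrow> 'w wgraph \<Rightarrow> 'w \<Rightarrow> bool" where
  "stronger_potential G x0 H y0 \<longleftrightarrow>
     (\<forall>r::nat. \<forall>x\<in>gsphere G x0 (int r). qpot G x \<ge> qpot_sym H y0 r)"

definition weaker_potential ::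
  "'v wgraph \<Rightarrow> 'v \<Rightarrow> 'w wgraph \<Rightarrow> 'w \<Rightarrow> bool" where
  "weaker_potential G x0 H y0 \<longleftrightarrow>
     (\<forall>r::nat. \<forall>x\<in>gsphere G x0 (int r). qpot G x \<le> qpot_sym H y0 r)"

text \<open>The sum over all vertices \<open>y\<close> reduces to the finite set of neighbors of \<open>x\<close>, because
  \<open>edge_weight G x y = 0\<close> for all other vertices.\<close>

definition laplacian :: "'v wgraph \<Rightarrow> ('v \<Rightarrow> real) \<Rightarrow> 'v \<Rightarrow> real" where
  "laplacian G f x =
     1 / meas G x * (\<Sum>y\<in>nbrs G x. edge_weight G x y * (f x - f y)) + pot G x / meas G x * f x"

text \<open>Only the values \<open>u x t\<close> with \<open>x\<close> a vertex and \<open>t \<ge> 0\<close> are relevant.\<close>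

definition heat_solution :: "'v wgraph \<Rightarrow> ('v \<Rightarrow> real) \<Rightarrow> ('v \<Rightarrow> real \<Rightarrow> real) \<Rightarrow> bool" where
  "heat_solution G u0 u \<longleftrightarrow> (\<forall>x\<in>verts G.
     continuous_on {0..} (u x) \<and>
     (\<forall>t>0. u x differentiable (at t) \<and> laplacian G (\<lambda>y. u y t) x + deriv (u x) t = 0) \<and>
     u x 0 = u0 x)"

text \<open>Of the equivalent characterisations of stochastic incompleteness at infinity (by bounded
  nonnegative \<open>\<alpha>\<close>-subharmonic functions, by bounded positive \<open>\<alpha>\<close>-harmonic functions, and by
  non-uniqueness of bounded solutions of the heat equation), the last one serves as the
  definition; it does not involve the parameter \<open>\<alpha>\<close>.\<close>

definition stochastically_incomplete :: "'v wgraph \<Rightarrow> bool" where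
  "stochastically_incomplete G \<longleftrightarrow> (\<exists>u. heat_solution G (\<lambda>_. 0) u \<and>
     (\<exists>C. \<forall>x\<in>verts G. \<forall>t\<ge>0. \<bar>u x t\<bar> \<le> C) \<and>
     (\<exists>x\<in>verts G. \<exists>t\<ge>0. u x t \<noteq> 0))"

definition stochastically_complete :: "'v wgraph \<Rightarrow> bool" where
  "stochastically_complete G \<longleftrightarrow> \<not> stochastically_incomplete G"

end

theory Submission imports Defs begin

text \<open>Stochastic incompleteness is first turned into an elliptic property: for any \<open>\<alpha> > 0\<close> it
  is equivalent to the existence of a bounded, nonnegative, non-zero \<open>v\<close> with
  \<open>(L + \<alpha>) v \<le> 0\<close>. Write \<open>L = D - A\<close> with the multiplication operator \<open>D\<close> and the
  positivity preserving operator \<open>A\<close>. Because \<open>A\<close> is monotone and \<open>A 1 \<le> D\<close>, iterating from the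
  constant \<open>1\<close> produces the largest solutions bounded by \<open>1\<close>, without exhausting the graph by
  finite pieces: \<open>w = A w / (D + \<alpha>)\<close> for the elliptic equation, and Duhamel's formula, with the
  integral of \<open>exp (- D (t - s)) A u(s)\<close> over \<open>0 \<le> s \<le> t\<close> equal to \<open>u(t)\<close>, for the heat equation with
  initial value \<open>0\<close>.
  A heat solution starting at \<open>0\<close> and bounded by \<open>C\<close> is at most
  \<open>C exp (\<alpha> t) w\<close> (\<open>heat_solution_le_resolvent_iter\<close>), so \<open>w\<close> is non-zero if the heat solution is.
  Conversely, if \<open>v\<close> is bounded by \<open>C\<close>, then
  \<open>exp (\<alpha> (t - T)) v / C - exp (- \<alpha> T)\<close> is a subsolution on \<open>[0, T]\<close> below \<open>1\<close> that is nonpositive at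
  time \<open>0\<close>; hence it stays below \<open>u\<close>, and for large \<open>T\<close> it is positive somewhere at time \<open>T\<close>
  (\<open>subsolution_imp_stochastically_incomplete\<close>).

  The comparison then takes place on the half line. The weakly spherically symmetric graph
  determines, through a second order recursion, a profile \<open>\<phi>\<close> with \<open>\<phi> 0 = 1\<close> for which
  \<open>\<phi> (d(x, o))\<close> solves \<open>(L + 1) f = 0\<close> there; it is positive and increasing. Transplanted to the
  other graph, \<open>\<phi> (d(x, x\<^sub>0))\<close> satisfies \<open>(L + 1) f \<le> 0\<close> under stronger curvature growth and weaker
  potential, and \<open>(L + 1) f \<ge> 0\<close> under the opposite hypotheses (\<open>laplacian_profile\<close>). In the
  first case boundedness of \<open>\<phi>\<close> gives incompleteness. In the second, an unbounded \<open>\<phi>\<close> is a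
  supersolution tending to infinity, and the maximum principle excludes every bounded subsolution,
  so incompleteness forces \<open>\<phi>\<close> to be bounded. A symmetric graph satisfies both sets of hypotheses
  relative to itself, hence is incomplete exactly when \<open>\<phi>\<close> is bounded, and both claims follow.\<close>

section \<open>Scalar differential inequalities and Duhamel's formula\<close>

text \<open>A one-sided Gronwall lemma: the integrating factor \<open>exp (D t)\<close> makes the function decreasing.
  It is the only comparison principle in time that is needed, because the iterations below
  decouple the vertices.\<close>

lemma differential_inequality_nonpos:
  fixes h h' :: "real \<Rightarrow> real" and D :: real
  assumes T: "0 \<le> T" and cont: "continuous_on {0..T} h" and init: "h 0 \<le> 0"
    and deriv: "\<And>t. 0 < t \<Longrightarrow> t < T \<Longrightarrow> (h has_real_derivative h' t) (at t)"
    and ineq: "\<And>t. 0 < t \<Longrightarrow> t < T \<Longrightarrow> h' t + D * h t \<le> 0"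
  shows "h T \<le> 0"
proof (cases "T = 0")
  case False
  have "exp (D * T) * h T \<le> exp (D * 0) * h 0"
  proof (rule DERIV_nonpos_imp_decreasing_open[OF T])
    fix t assume t: "0 < t" "t < T"
    have "((\<lambda>t. exp (D * t) * h t) has_real_derivative exp (D * t) * (h' t + D * h t)) (at t)"
      by (auto intro!: derivative_eq_intros deriv[OF t] simp: algebra_simps)
    then show "\<exists>y. ((\<lambda>t. exp (D * t) * h t) has_real_derivative y) (at t) \<and> y \<le> 0"
      using ineq[OF t] by (meson exp_ge_zero mult_nonneg_nonpos)
  next
    show "continuous_on {0..T} (\<lambda>t. exp (D * t) * h t)"
      by (intro continuous_intros cont)
  qed
  with init have "exp (D * T) * h T \<le> 0" by simp
  then show ?thesis by (simp add: mult_le_0_iff not_le[symmetric])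
qed (use init in simp)

text \<open>For continuous \<open>g\<close> this is the solution of \<open>h' = g - D h\<close> with \<open>h 0 = 0\<close>.\<close>

definition duhamel :: "real \<Rightarrow> (real \<Rightarrow> real) \<Rightarrow> real \<Rightarrow> real" where
  "duhamel D g t = exp (- D * t) * integral {0..t} (\<lambda>s. exp (D * s) * g s)"

lemma duhamel_at_0 [simp]: "duhamel D g 0 = 0"
  by (simp add: duhamel_def)

text \<open>Integrability suffices here, which matters for the limit of the heat iteration: its
  continuity is deduced from this lemma and is not available beforehand.\<close>

lemma continuous_on_duhamel:
  assumes "\<And>T. (\<lambda>s. exp (D * s) * g s) integrable_on {0..T}"
  shows "continuous_on {0..T} (duhamel D g)"
  unfolding duhamel_def[abs_def]
  by (intro continuous_intros indefinite_integral_continuous_1 assms)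

lemma duhamel_has_derivative:
  assumes cont: "continuous_on {0..} g" and t: "0 < t"
  shows "(duhamel D g has_real_derivative g t - D * duhamel D g t) (at t)"
proof -
  have "continuous_on {0..t + 1} (\<lambda>s. exp (D * s) * g s)"
    by (intro continuous_intros continuous_on_subset[OF cont]) auto
  then have "((\<lambda>t. integral {0..t} (\<lambda>s. exp (D * s) * g s)) has_real_derivative
      exp (D * t) * g t) (at t within {0..t + 1})"
    using t integral_has_real_derivative[of 0 "t + 1" "\<lambda>s. exp (D * s) * g s" t] by simp
  then have I: "((\<lambda>t. integral {0..t} (\<lambda>s. exp (D * s) * g s)) has_real_derivative
      exp (D * t) * g t) (at t)"
    using t at_within_Icc_at[of 0 t "t + 1"] by simp
  have "((\<lambda>t. exp (- D * t)) has_real_derivative - D * exp (- D * t)) (at t)"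
    by (auto intro!: derivative_eq_intros)
  from DERIV_mult[OF this I] show ?thesis
    unfolding duhamel_def[abs_def]
    by (rule DERIV_cong) (simp add: exp_minus field_simps)
qed

lemma exp_weight_integrable:
  assumes "continuous_on {0..} g"
  shows "(\<lambda>s::real. exp (D * s) * g s :: real) integrable_on {0..T}"
  by (intro integrable_continuous_real continuous_intros continuous_on_subset[OF assms]) auto

lemma continuous_on_duhamel_unbounded:
  assumes "\<And>T. (\<lambda>s. exp (D * s) * g s) integrable_on {0..T}"
  shows "continuous_on {0..} (duhamel D g)"
proof -
  have "continuous (at t within {0..}) (duhamel D g)" if "t \<ge> 0" for t
  proof -
    have "at t within {0..} = at t within {0..t + 1}"
      by (rule at_within_nhd[of _ "{..<t+1}"]) (use that in auto)
    then show ?thesis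
      using continuous_on_duhamel[OF assms, of "t + 1"] that
      by (auto simp: continuous_on_eq_continuous_within)
  qed
  then show ?thesis by (simp add: continuous_on_eq_continuous_within)
qed

section \<open>The Laplacian as a diagonal part minus a monotone part\<close>

definition decay_rate :: "'v wgraph \<Rightarrow> 'v \<Rightarrow> real" where
  "decay_rate G x = (\<Sum>y\<in>nbrs G x. edge_weight G x y) / meas G x + pot G x / meas G x"

definition inflow :: "'v wgraph \<Rightarrow> ('v \<Rightarrow> real) \<Rightarrow> 'v \<Rightarrow> real" where
  "inflow G f x = (\<Sum>y\<in>nbrs G x. edge_weight G x y / meas G x * f y)"

lemma laplacian_eq: "laplacian G f x = decay_rate G x * f x - inflow G f x"
  by (simp add: laplacian_def decay_rate_def inflow_def right_diff_distrib sum_subtractf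
      sum_distrib_right sum_divide_distrib diff_divide_distrib distrib_right)

lemma inflow_cmult: "inflow G (\<lambda>y. c * f y) x = c * inflow G f x"
  by (simp add: inflow_def sum_distrib_left mult_ac)

lemma inflow_diff: "inflow G (\<lambda>y. f y - g y) x = inflow G f x - inflow G g x"
  by (simp add: inflow_def sum_subtractf right_diff_distrib)

lemma tendsto_inflow:
  assumes "\<And>y. y \<in> nbrs G x \<Longrightarrow> (\<lambda>k. f k y) \<longlonglongrightarrow> g y"
  shows "(\<lambda>k. inflow G (f k) x) \<longlonglongrightarrow> inflow G g x"
  unfolding inflow_def by (intro tendsto_intros assms)

text \<open>The equation \<open>(L + \<alpha>) w = 0\<close> is the fixed point equation \<open>w = A w / (D + \<alpha>)\<close>.\<close>

primrec resolvent_iter :: "'v wgraph \<Rightarrow> real \<Rightarrow> nat \<Rightarrow> 'v \<Rightarrow> real" where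
  "resolvent_iter G \<alpha> 0 = (\<lambda>x. 1)"
| "resolvent_iter G \<alpha> (Suc k) =
     (\<lambda>x. inflow G (resolvent_iter G \<alpha> k) x / (decay_rate G x + \<alpha>))"

text \<open>The constant \<open>1\<close> at the start violates the initial condition \<open>0\<close>, but every later iterate
  satisfies it.\<close>

primrec heat_iter :: "'v wgraph \<Rightarrow> nat \<Rightarrow> 'v \<Rightarrow> real \<Rightarrow> real" where
  "heat_iter G 0 = (\<lambda>x t. 1)"
| "heat_iter G (Suc k) =
     (\<lambda>x. duhamel (decay_rate G x) (\<lambda>s. inflow G (\<lambda>y. heat_iter G k y s) x))"

definition bounded_subsolution :: "'v wgraph \<Rightarrow> real \<Rightarrow> ('v \<Rightarrow> real) \<Rightarrow> bool" where
  "bounded_subsolution G \<alpha> v \<longleftrightarrow>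
     (\<forall>x\<in>verts G. 0 \<le> v x) \<and> (\<exists>C. \<forall>x\<in>verts G. v x \<le> C) \<and> (\<exists>x\<in>verts G. v x \<noteq> 0) \<and>
     (\<forall>x\<in>verts G. laplacian G v x + \<alpha> * v x \<le> 0)"

context weighted_graph
begin

lemma nbrs_in_verts: "y \<in> nbrs G x \<Longrightarrow> y \<in> verts G"
  by (simp add: nbrs_def)

lemma inflow_mono:
  assumes "x \<in> verts G" and "\<And>y. y \<in> verts G \<Longrightarrow> f y \<le> g y"
  shows "inflow G f x \<le> inflow G g x"
  unfolding inflow_def using assms meas_pos[of x]
  by (intro sum_mono mult_left_mono) (auto simp: nbrs_def)

lemma decay_rate_nonneg: "x \<in> verts G \<Longrightarrow> 0 \<le> decay_rate G x"
  unfolding decay_rate_def using meas_pos[of x] pot_nonneg[of x]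
  by (intro add_nonneg_nonneg divide_nonneg_pos sum_nonneg) (auto simp: nbrs_def)

text \<open>Nonnegative constants are supersolutions, because the potential is nonnegative. This is what
  makes both iterations started at \<open>1\<close> decrease.\<close>

lemma inflow_const_le:
  assumes "x \<in> verts G" and "0 \<le> c"
  shows "inflow G (\<lambda>y. c) x \<le> decay_rate G x * c"
proof -
  have "inflow G (\<lambda>y. c) x = (\<Sum>y\<in>nbrs G x. edge_weight G x y) / meas G x * c"
    by (simp add: inflow_def sum_distrib_right sum_divide_distrib)
  also have "\<dots> \<le> decay_rate G x * c"
    unfolding decay_rate_def using meas_pos[of x] pot_nonneg[of x] assms
    by (intro mult_right_mono) auto
  finally show ?thesis .
qed

lemma inflow_nonneg:
  assumes "x \<in> verts G" and "\<And>y. y \<in> verts G \<Longrightarrow> 0 \<le> f y"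
  shows "0 \<le> inflow G f x"
  using inflow_mono[of x "\<lambda>_. 0" f] assms by (simp add: inflow_def)

section \<open>Incompleteness yields a bounded subsolution\<close>

lemma resolvent_iter_nonneg:
  assumes "0 < \<alpha>" and "x \<in> verts G"
  shows "0 \<le> resolvent_iter G \<alpha> k x"
  using assms(2)
proof (induction k arbitrary: x)
  case (Suc k)
  then show ?case
    using inflow_nonneg[of x "resolvent_iter G \<alpha> k"] decay_rate_nonneg[of x] assms(1) by simp
qed simp

lemma resolvent_iter_decreasing:
  assumes "0 < \<alpha>" and "x \<in> verts G"
  shows "resolvent_iter G \<alpha> (Suc k) x \<le> resolvent_iter G \<alpha> k x"
  using assms(2)
proof (induction k arbitrary: x)
  case 0
  then show ?case
    using inflow_const_le[of x 1] decay_rate_nonneg[of x] assms(1) by simp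
next
  case (Suc k)
  have "inflow G (resolvent_iter G \<alpha> (Suc k)) x \<le> inflow G (resolvent_iter G \<alpha> k) x"
    by (intro inflow_mono Suc)
  then show ?case
    using decay_rate_nonneg[of x] assms(1) Suc.prems
    by (simp add: divide_right_mono)
qed

lemma resolvent_limit_exists:
  assumes "0 < \<alpha>"
  shows "\<exists>w. \<forall>x\<in>verts G. (\<lambda>k. resolvent_iter G \<alpha> k x) \<longlonglongrightarrow> w x \<and> 0 \<le> w x \<and> w x \<le> 1
           \<and> laplacian G w x + \<alpha> * w x = 0"
proof -
  define w where "w = (\<lambda>x. lim (\<lambda>k. resolvent_iter G \<alpha> k x))"
  have dec: "decseq (\<lambda>k. resolvent_iter G \<alpha> k x)" if "x \<in> verts G" for x
    using resolvent_iter_decreasing[OF assms that] by (rule decseq_SucI)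
  have lim: "(\<lambda>k. resolvent_iter G \<alpha> k x) \<longlonglongrightarrow> w x" if "x \<in> verts G" for x
    using decseq_convergent[OF dec[OF that], of 0] resolvent_iter_nonneg[OF assms that]
    unfolding w_def by (metis limI)
  have nonneg: "0 \<le> w x" if "x \<in> verts G" for x
    using LIMSEQ_le_const[OF lim[OF that]] resolvent_iter_nonneg[OF assms that] by blast
  have le1: "w x \<le> 1" if "x \<in> verts G" for x
    using decseq_ge[OF dec[OF that] lim[OF that], of 0] by simp
  have "laplacian G w x + \<alpha> * w x = 0" if x: "x \<in> verts G" for x
  proof -
    have pos: "0 < decay_rate G x + \<alpha>" using decay_rate_nonneg[OF x] assms by simp
    have "(\<lambda>k. resolvent_iter G \<alpha> (Suc k) x) \<longlonglongrightarrow> inflow G w x / (decay_rate G x + \<alpha>)"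
      unfolding resolvent_iter.simps
      by (intro tendsto_intros tendsto_inflow lim nbrs_in_verts) (use pos in auto)
    with LIMSEQ_Suc[OF lim[OF x]] have "w x = inflow G w x / (decay_rate G x + \<alpha>)"
      by (rule LIMSEQ_unique)
    then show ?thesis using pos by (simp add: laplacian_eq field_simps)
  qed
  with lim nonneg le1 show ?thesis by blast
qed

lemma heat_solutionD:
  assumes "heat_solution G u0 u" and "x \<in> verts G"
  shows "continuous_on {0..} (u x)" and "u x 0 = u0 x"
    and "0 < t \<Longrightarrow> (u x has_real_derivative - laplacian G (\<lambda>y. u y t) x) (at t)"
proof -
  have *: "continuous_on {0..} (u x) \<and> (\<forall>t>0. u x differentiable (at t) \<and>
      laplacian G (\<lambda>y. u y t) x + deriv (u x) t = 0) \<and> u x 0 = u0 x"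
    using assms unfolding heat_solution_def by (rule bspec)
  then show "continuous_on {0..} (u x)" "u x 0 = u0 x" by simp_all
  assume "0 < t"
  with * have "u x differentiable (at t)" "deriv (u x) t = - laplacian G (\<lambda>y. u y t) x"
    by (simp_all add: add_eq_0_iff)
  then show "(u x has_real_derivative - laplacian G (\<lambda>y. u y t) x) (at t)"
    by (metis DERIV_imp_deriv real_differentiable_def)
qed

lemma heat_solutionI:
  assumes "\<And>x. x \<in> verts G \<Longrightarrow> continuous_on {0..} (u x)"
    and "\<And>x. x \<in> verts G \<Longrightarrow> u x 0 = u0 x"
    and "\<And>x t. x \<in> verts G \<Longrightarrow> 0 < t \<Longrightarrow>
           (u x has_real_derivative - laplacian G (\<lambda>y. u y t) x) (at t)"
  shows "heat_solution G u0 u"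
  unfolding heat_solution_def
proof (intro ballI conjI allI impI)
  fix x and t :: real assume x: "x \<in> verts G" and t: "0 < t"
  show "u x differentiable (at t)"
    using assms(3)[OF x t] unfolding real_differentiable_def by blast
  show "laplacian G (\<lambda>y. u y t) x + deriv (u x) t = 0"
    using DERIV_imp_deriv[OF assms(3)[OF x t]] by simp
qed (use assms in auto)

text \<open>If \<open>u \<le> C exp (\<alpha> t) w\<^sub>k\<close> at all vertices, then at a fixed vertex both \<open>u\<close> and
  \<open>C exp (\<alpha> t) w\<^sub>k\<^sub>+\<^sub>1\<close> solve scalar equations \<open>h' + D h = A(\<dots>)\<close> whose right-hand sides are ordered, and
  the scalar lemma gives the next estimate. This replaces a maximum principle on the space-time
  cylinder, which is not available as \<open>u\<close> need not attain its supremum.\<close>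

lemma heat_solution_le_resolvent_iter:
  assumes \<alpha>: "0 < \<alpha>" and sol: "heat_solution G (\<lambda>_. 0) u"
    and bound: "\<And>x t. x \<in> verts G \<Longrightarrow> 0 \<le> t \<Longrightarrow> u x t \<le> C" and C: "0 \<le> C"
    and x: "x \<in> verts G" and t: "0 \<le> t"
  shows "u x t \<le> C * exp (\<alpha> * t) * resolvent_iter G \<alpha> k x"
  using x t
proof (induction k arbitrary: x t)
  case 0
  have "C * 1 \<le> C * exp (\<alpha> * t)" using 0 \<alpha> C by (intro mult_left_mono) auto
  then show ?case using bound[OF 0] by simp
next
  case (Suc k)
  note x = Suc.prems(1)
  define w where "w = resolvent_iter G \<alpha> (Suc k) x"
  have pos: "0 < decay_rate G x + \<alpha>" using decay_rate_nonneg[OF x] \<alpha> by simp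
  have w: "(decay_rate G x + \<alpha>) * w = inflow G (resolvent_iter G \<alpha> k) x"
    using pos by (simp add: w_def)
  have w0: "0 \<le> w" unfolding w_def by (rule resolvent_iter_nonneg[OF \<alpha> x])
  have "u x t - C * exp (\<alpha> * t) * w \<le> 0"
  proof (rule differential_inequality_nonpos[where D = "decay_rate G x" and T = t
        and h = "\<lambda>t. u x t - C * exp (\<alpha> * t) * w"
        and h' = "\<lambda>s. - laplacian G (\<lambda>y. u y s) x - C * (\<alpha> * exp (\<alpha> * s)) * w"])
    show "continuous_on {0..t} (\<lambda>t. u x t - C * exp (\<alpha> * t) * w)"
      by (intro continuous_intros continuous_on_subset[OF heat_solutionD(1)[OF sol x]]) auto
    show "u x 0 - C * exp (\<alpha> * 0) * w \<le> 0"
      using heat_solutionD(2)[OF sol x] C w0 by simp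
    fix s assume s: "0 < s" "s < t"
    show "((\<lambda>t. u x t - C * exp (\<alpha> * t) * w) has_real_derivative
                 - laplacian G (\<lambda>y. u y s) x - C * (\<alpha> * exp (\<alpha> * s)) * w) (at s)"
      by (auto intro!: derivative_eq_intros heat_solutionD(3)[OF sol x s(1)])
    have "inflow G (\<lambda>y. u y s) x
        \<le> inflow G (\<lambda>y. C * exp (\<alpha> * s) * resolvent_iter G \<alpha> k y) x"
      using s by (intro inflow_mono Suc.IH x) auto
    moreover have "\<dots> = C * exp (\<alpha> * s) * ((decay_rate G x + \<alpha>) * w)"
      by (simp only: inflow_cmult w)
    ultimately show "- laplacian G (\<lambda>y. u y s) x - C * (\<alpha> * exp (\<alpha> * s)) * w
        + decay_rate G x * (u x s - C * exp (\<alpha> * s) * w) \<le> 0"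
      by (simp add: laplacian_eq algebra_simps)
  qed (use Suc.prems in auto)
  then show ?case unfolding w_def by simp
qed

lemma heat_solution_minus:
  assumes "heat_solution G (\<lambda>_. 0) u"
  shows "heat_solution G (\<lambda>_. 0) (\<lambda>x t. - u x t)"
proof (rule heat_solutionI)
  fix x assume x: "x \<in> verts G"
  show "continuous_on {0..} (\<lambda>t. - u x t)"
    by (intro continuous_on_minus heat_solutionD(1)[OF assms x])
  show "- u x 0 = 0" using heat_solutionD(2)[OF assms x] by simp
  fix t :: real assume t: "0 < t"
  show "((\<lambda>t. - u x t) has_real_derivative - laplacian G (\<lambda>y. - u y t) x) (at t)"
    using DERIV_minus[OF heat_solutionD(3)[OF assms x t]]
      inflow_cmult[of G "-1" "\<lambda>y. u y t" x] by (simp add: laplacian_eq)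
qed

lemma stochastically_incomplete_imp_subsolution:
  assumes inc: "stochastically_incomplete G" and \<alpha>: "0 < \<alpha>"
  shows "\<exists>v. bounded_subsolution G \<alpha> v"
proof -
  obtain u C where sol: "heat_solution G (\<lambda>_. 0) u"
    and C: "\<And>x t. x \<in> verts G \<Longrightarrow> t \<ge> 0 \<Longrightarrow> \<bar>u x t\<bar> \<le> C"
    and nz: "\<exists>x\<in>verts G. \<exists>t\<ge>0. u x t \<noteq> 0"
    using inc unfolding stochastically_incomplete_def by metis
  obtain w where lim: "\<And>x. x \<in> verts G \<Longrightarrow> (\<lambda>k. resolvent_iter G \<alpha> k x) \<longlonglongrightarrow> w x"
    and w: "\<And>x. x \<in> verts G \<Longrightarrow> 0 \<le> w x \<and> w x \<le> 1 \<and> laplacian G w x + \<alpha> * w x = 0"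
    using resolvent_limit_exists[OF \<alpha>] by metis
  from nz obtain x t where x: "x \<in> verts G" and t: "0 \<le> t" and uxt: "u x t \<noteq> 0" by blast
  have C0: "0 \<le> C" using C[OF x t] by linarith
  have below: "\<bar>u x t\<bar> \<le> C * exp (\<alpha> * t) * resolvent_iter G \<alpha> k x" for k
    using heat_solution_le_resolvent_iter[OF \<alpha> sol _ C0 x t, of k]
      heat_solution_le_resolvent_iter[OF \<alpha> heat_solution_minus[OF sol] _ C0 x t, of k] C
    by (fastforce simp: abs_le_iff)
  have "(\<lambda>k. C * exp (\<alpha> * t) * resolvent_iter G \<alpha> k x) \<longlonglongrightarrow> C * exp (\<alpha> * t) * w x"
    by (intro tendsto_intros lim x)
  then have "\<bar>u x t\<bar> \<le> C * exp (\<alpha> * t) * w x"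
    by (rule LIMSEQ_le_const) (use below in blast)
  with uxt have "w x \<noteq> 0" by auto
  with x w have "bounded_subsolution G \<alpha> w"
    unfolding bounded_subsolution_def by (intro conjI exI[of _ 1] bexI[of _ x]) auto
  then show ?thesis by blast
qed

section \<open>A bounded subsolution yields incompleteness\<close>

lemma continuous_on_inflow:
  assumes "\<And>y. y \<in> verts G \<Longrightarrow> continuous_on S (f y)"
  shows "continuous_on S (\<lambda>s. inflow G (\<lambda>y. f y s) x)"
  unfolding inflow_def by (intro continuous_intros assms nbrs_in_verts)

lemma continuous_on_heat_iter:
  "x \<in> verts G \<Longrightarrow> continuous_on {0..} (heat_iter G k x)"
  by (induction k arbitrary: x)
     (auto intro!: continuous_on_duhamel_unbounded exp_weight_integrable continuous_on_inflow)

lemma heat_iter_has_derivative: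
  assumes "0 < t"
  shows "(heat_iter G (Suc k) x has_real_derivative
     inflow G (\<lambda>y. heat_iter G k y t) x - decay_rate G x * heat_iter G (Suc k) x t) (at t)"
  unfolding heat_iter.simps
  by (rule duhamel_has_derivative[OF continuous_on_inflow[OF continuous_on_heat_iter] assms])

text \<open>The heat iterates dominate every subsolution below \<open>1\<close> with nonpositive initial values, so
  their limit is the largest bounded solution that starts at \<open>0\<close> and stays below \<open>1\<close>. The
  time horizon is finite because the subsolution of interest exceeds \<open>1\<close> eventually.\<close>

lemma subsolution_le_heat_iter:
  assumes cont: "\<And>x. x \<in> verts G \<Longrightarrow> continuous_on {0..T} (z x)"
    and deriv: "\<And>x t. x \<in> verts G \<Longrightarrow> 0 < t \<Longrightarrow> t < T \<Longrightarrow>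
                  (z x has_real_derivative z' x t) (at t)"
    and ineq: "\<And>x t. x \<in> verts G \<Longrightarrow> 0 < t \<Longrightarrow> t < T \<Longrightarrow> z' x t + laplacian G (\<lambda>y. z y t) x \<le> 0"
    and init: "\<And>x. x \<in> verts G \<Longrightarrow> z x 0 \<le> 0"
    and le1: "\<And>x t. x \<in> verts G \<Longrightarrow> 0 \<le> t \<Longrightarrow> t \<le> T \<Longrightarrow> z x t \<le> 1"
    and "x \<in> verts G" and "0 \<le> t" and "t \<le> T"
  shows "z x t \<le> heat_iter G k x t"
  using \<open>x \<in> verts G\<close> \<open>0 \<le> t\<close> \<open>t \<le> T\<close>
proof (induction k arbitrary: x t)
  case 0
  then show ?case using le1 by simp
next
  case (Suc k)
  note x = Suc.prems(1)
  have "z x t - heat_iter G (Suc k) x t \<le> 0"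
  proof (rule differential_inequality_nonpos[where D = "decay_rate G x" and T = t
        and h = "\<lambda>t. z x t - heat_iter G (Suc k) x t"
        and h' = "\<lambda>s. z' x s -
          (inflow G (\<lambda>y. heat_iter G k y s) x - decay_rate G x * heat_iter G (Suc k) x s)"])
    show "continuous_on {0..t} (\<lambda>t. z x t - heat_iter G (Suc k) x t)"
      by (intro continuous_intros continuous_on_subset[OF cont[OF x]]
          continuous_on_subset[OF continuous_on_heat_iter[OF x]]) (use Suc.prems in auto)
    show "z x 0 - heat_iter G (Suc k) x 0 \<le> 0" using init[OF x] by simp
    fix s assume s: "0 < s" "s < t"
    then have s': "s < T" using Suc.prems by simp
    show "((\<lambda>t. z x t - heat_iter G (Suc k) x t) has_real_derivative z' x s -
          (inflow G (\<lambda>y. heat_iter G k y s) x - decay_rate G x * heat_iter G (Suc k) x s)) (at s)"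
      by (intro DERIV_diff deriv heat_iter_has_derivative x s s')
    have "inflow G (\<lambda>y. z y s) x \<le> inflow G (\<lambda>y. heat_iter G k y s) x"
      using s s' by (intro inflow_mono Suc.IH x) auto
    then show "z' x s -
          (inflow G (\<lambda>y. heat_iter G k y s) x - decay_rate G x * heat_iter G (Suc k) x s)
        + decay_rate G x * (z x s - heat_iter G (Suc k) x s) \<le> 0"
      using ineq[OF x s(1) s'] by (simp add: laplacian_eq algebra_simps)
  qed (use Suc.prems in auto)
  then show ?case by simp
qed

lemma heat_iter_nonneg:
  assumes "x \<in> verts G" and "0 \<le> t"
  shows "0 \<le> heat_iter G k x t"
  using subsolution_le_heat_iter[of t "\<lambda>x t. 0" "\<lambda>x t. 0" x t k] assms
  by (simp add: laplacian_eq inflow_def)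

lemma heat_iter_decreasing:
  assumes "x \<in> verts G" and "0 \<le> t"
  shows "heat_iter G (Suc k) x t \<le> heat_iter G k x t"
  using assms
proof (induction k arbitrary: x t)
  case 0
  note x = 0(1)
  have "heat_iter G (Suc 0) x t - 1 \<le> 0"
  proof (rule differential_inequality_nonpos[where D = "decay_rate G x" and T = t
        and h = "\<lambda>t. heat_iter G (Suc 0) x t - 1"
        and h' = "\<lambda>s.
          inflow G (\<lambda>y. 1) x - decay_rate G x * heat_iter G (Suc 0) x s"])
    show "continuous_on {0..t} (\<lambda>t. heat_iter G (Suc 0) x t - 1)"
      by (intro continuous_intros
          continuous_on_subset[OF continuous_on_heat_iter[OF x]]) auto
    fix s assume s: "0 < s" "s < t"
    show "((\<lambda>t. heat_iter G (Suc 0) x t - 1) has_real_derivative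
        inflow G (\<lambda>y. 1) x - decay_rate G x * heat_iter G (Suc 0) x s) (at s)"
      using DERIV_diff[OF heat_iter_has_derivative[OF s(1), of 0 x] DERIV_const[of 1]] by simp
    show "inflow G (\<lambda>y. 1) x - decay_rate G x * heat_iter G (Suc 0) x s
        + decay_rate G x * (heat_iter G (Suc 0) x s - 1) \<le> 0"
      using inflow_const_le[OF x, of 1] by (simp add: algebra_simps)
  qed (use 0 in auto)
  then show ?case by simp
next
  case (Suc k)
  note x = Suc.prems(1)
  have "heat_iter G (Suc (Suc k)) x t - heat_iter G (Suc k) x t \<le> 0"
  proof (rule differential_inequality_nonpos[where D = "decay_rate G x" and T = t
        and h = "\<lambda>t. heat_iter G (Suc (Suc k)) x t - heat_iter G (Suc k) x t"
        and h' = "\<lambda>s.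
          (inflow G (\<lambda>y. heat_iter G (Suc k) y s) x
             - decay_rate G x * heat_iter G (Suc (Suc k)) x s)
        - (inflow G (\<lambda>y. heat_iter G k y s) x - decay_rate G x * heat_iter G (Suc k) x s)"])
    show "continuous_on {0..t} (\<lambda>t. heat_iter G (Suc (Suc k)) x t - heat_iter G (Suc k) x t)"
      by (intro continuous_intros
          continuous_on_subset[OF continuous_on_heat_iter[OF x]]) auto
    fix s assume s: "0 < s" "s < t"
    show "((\<lambda>t. heat_iter G (Suc (Suc k)) x t - heat_iter G (Suc k) x t) has_real_derivative
        (inflow G (\<lambda>y. heat_iter G (Suc k) y s) x
             - decay_rate G x * heat_iter G (Suc (Suc k)) x s)
        - (inflow G (\<lambda>y. heat_iter G k y s) x - decay_rate G x * heat_iter G (Suc k) x s)) (at s)"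
      by (intro DERIV_diff heat_iter_has_derivative s)
    have "inflow G (\<lambda>y. heat_iter G (Suc k) y s) x \<le> inflow G (\<lambda>y. heat_iter G k y s) x"
      using s by (intro inflow_mono Suc.IH x) auto
    then show "(inflow G (\<lambda>y. heat_iter G (Suc k) y s) x
             - decay_rate G x * heat_iter G (Suc (Suc k)) x s)
        - (inflow G (\<lambda>y. heat_iter G k y s) x - decay_rate G x * heat_iter G (Suc k) x s)
        + decay_rate G x * (heat_iter G (Suc (Suc k)) x s - heat_iter G (Suc k) x s) \<le> 0"
      by (simp add: algebra_simps)
  qed (use Suc.prems in auto)
  then show ?case by simp
qed

text \<open>The monotone limit inherits Duhamel's formula by dominated convergence. The formula then
  upgrades its regularity: the right-hand side is continuous for a merely integrable integrand, and
  differentiable once the limit is known to be continuous.\<close>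

lemma heat_limit_exists:
  "\<exists>u. heat_solution G (\<lambda>_. 0) u \<and>
     (\<forall>x\<in>verts G. \<forall>t\<ge>0. (\<lambda>k. heat_iter G k x t) \<longlonglongrightarrow> u x t \<and> 0 \<le> u x t \<and> u x t \<le> 1)"
proof -
  define u where "u = (\<lambda>x t. lim (\<lambda>k. heat_iter G k x t))"
  have dec: "decseq (\<lambda>k. heat_iter G k x t)" if "x \<in> verts G" "0 \<le> t" for x t
    using heat_iter_decreasing[OF that] by (rule decseq_SucI)
  have lim: "(\<lambda>k. heat_iter G k x t) \<longlonglongrightarrow> u x t" if "x \<in> verts G" "0 \<le> t" for x t
    using decseq_convergent[OF dec[OF that], of 0] heat_iter_nonneg[OF that]
    unfolding u_def by (metis limI)
  have nonneg: "0 \<le> u x t" if "x \<in> verts G" "0 \<le> t" for x t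
    using LIMSEQ_le_const[OF lim[OF that]] heat_iter_nonneg[OF that] by blast
  have iter_le1: "heat_iter G k x t \<le> 1" if "x \<in> verts G" "0 \<le> t" for x t k
    using decseqD[OF dec[OF that], of 0 k] by simp
  have le1: "u x t \<le> 1" if "x \<in> verts G" "0 \<le> t" for x t
    using decseq_ge[OF dec[OF that] lim[OF that], of 0] by simp
  have inflow_bound: "\<bar>inflow G (\<lambda>y. heat_iter G k y s) x\<bar> \<le> decay_rate G x"
    if x: "x \<in> verts G" and s: "0 \<le> s" for x s k
  proof -
    have "inflow G (\<lambda>y. heat_iter G k y s) x \<le> inflow G (\<lambda>y. 1) x"
      by (intro inflow_mono x iter_le1 s)
    moreover have "0 \<le> inflow G (\<lambda>y. heat_iter G k y s) x"
      by (intro inflow_nonneg x heat_iter_nonneg s)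
    ultimately show ?thesis using inflow_const_le[OF x, of 1] by simp
  qed
  have dom: "(\<lambda>s. exp (decay_rate G x * s) * inflow G (\<lambda>y. u y s) x) integrable_on {0..t}"
    "(\<lambda>k. integral {0..t} (\<lambda>s. exp (decay_rate G x * s) * inflow G (\<lambda>y. heat_iter G k y s) x))
       \<longlonglongrightarrow> integral {0..t} (\<lambda>s. exp (decay_rate G x * s) * inflow G (\<lambda>y. u y s) x)"
    if x: "x \<in> verts G" for x t
  proof -
    let ?D = "decay_rate G x"
    have 1: "(\<lambda>s. exp (?D * s) * inflow G (\<lambda>y. heat_iter G k y s) x) integrable_on {0..t}" for k
      by (intro exp_weight_integrable continuous_on_inflow continuous_on_heat_iter)
    have 2: "(\<lambda>s. exp (?D * s) * ?D) integrable_on {0..t}"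
      by (intro integrable_continuous_real continuous_intros)
    have 3: "norm (exp (?D * s) * inflow G (\<lambda>y. heat_iter G k y s) x) \<le> exp (?D * s) * ?D"
      if "s \<in> {0..t}" for k s
      using inflow_bound[OF x, of s k] that by (simp add: abs_mult)
    have 4: "(\<lambda>k. exp (?D * s) * inflow G (\<lambda>y. heat_iter G k y s) x)
        \<longlonglongrightarrow> exp (?D * s) * inflow G (\<lambda>y. u y s) x" if "s \<in> {0..t}" for s
      by (intro tendsto_intros tendsto_inflow lim nbrs_in_verts) (use that in auto)
    show "(\<lambda>s. exp (?D * s) * inflow G (\<lambda>y. u y s) x) integrable_on {0..t}"
      "(\<lambda>k. integral {0..t} (\<lambda>s. exp (?D * s) * inflow G (\<lambda>y. heat_iter G k y s) x))
       \<longlonglongrightarrow> integral {0..t} (\<lambda>s. exp (?D * s) * inflow G (\<lambda>y. u y s) x)"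
      using dominated_convergence[OF 1 2 3 4] by auto
  qed
  have fixpoint: "u x t = duhamel (decay_rate G x) (\<lambda>s. inflow G (\<lambda>y. u y s) x) t"
    if x: "x \<in> verts G" and t: "0 \<le> t" for x t
  proof -
    have "(\<lambda>k. heat_iter G (Suc k) x t)
        \<longlonglongrightarrow> duhamel (decay_rate G x) (\<lambda>s. inflow G (\<lambda>y. u y s) x) t"
      unfolding heat_iter.simps duhamel_def by (intro tendsto_intros dom x)
    with LIMSEQ_Suc[OF lim[OF x t]] show ?thesis by (rule LIMSEQ_unique)
  qed
  have cont: "continuous_on {0..} (u x)" if x: "x \<in> verts G" for x
    using continuous_on_duhamel_unbounded[OF dom(1)[OF x]] fixpoint[OF x]
    by (subst continuous_on_cong[OF refl]) auto
  have deriv: "(u x has_real_derivative - laplacian G (\<lambda>y. u y t) x) (at t)"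
    if x: "x \<in> verts G" and t: "0 < t" for x t
  proof -
    have "continuous_on {0..} (\<lambda>s. inflow G (\<lambda>y. u y s) x)"
      by (intro continuous_on_inflow cont)
    then have "(duhamel (decay_rate G x) (\<lambda>s. inflow G (\<lambda>y. u y s) x) has_real_derivative
        - laplacian G (\<lambda>y. u y t) x) (at t)"
      using duhamel_has_derivative[of _ t "decay_rate G x"] fixpoint[OF x, of t] t
      by (simp add: laplacian_eq)
    then show ?thesis
      by (rule has_field_derivative_transform_within_open[of _ _ _ "{0<..}"])
         (use t fixpoint[OF x] in auto)
  qed
  have "heat_solution G (\<lambda>_. 0) u"
    by (rule heat_solutionI) (use cont deriv fixpoint in auto)
  with lim nonneg le1 show ?thesis by blast
qed

text \<open>The function \<open>exp (\<alpha> t) v\<close> is a subsolution of the heat equation that starts at \<open>v \<le> C\<close>, and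
  \<open>C\<close> is a supersolution. Their difference, scaled by \<open>exp (- \<alpha> T) / C\<close> to stay below \<open>1\<close> until time
  \<open>T\<close>, is a lower barrier for the heat iterates. The exponential growth of the first term beats the
  constant, so the barrier is positive at time \<open>T\<close> once \<open>exp (\<alpha> T) v x > C\<close>.\<close>

lemma subsolution_imp_stochastically_incomplete:
  assumes \<alpha>: "0 < \<alpha>" and v: "bounded_subsolution G \<alpha> v"
  shows "stochastically_incomplete G"
proof -
  obtain x C where x: "x \<in> verts G" and "v x \<noteq> 0" and C: "\<And>y. y \<in> verts G \<Longrightarrow> v y \<le> C"
    and v0: "\<And>y. y \<in> verts G \<Longrightarrow> 0 \<le> v y"
    and sub: "\<And>y. y \<in> verts G \<Longrightarrow> laplacian G v y + \<alpha> * v y \<le> 0"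
    using v unfolding bounded_subsolution_def by metis
  have vx: "0 < v x" using v0[OF x] \<open>v x \<noteq> 0\<close> by simp
  have Cpos: "0 < C" using vx C[OF x] by linarith
  define T where "T = max 0 (ln (C / v x) / \<alpha> + 1)"
  define z where "z = (\<lambda>y t. exp (\<alpha> * (t - T)) / C * v y - exp (- \<alpha> * T))"
  have T0: "0 \<le> T" by (simp add: T_def)
  have "ln (C / v x) < \<alpha> * T"
    using \<alpha> by (simp add: T_def max_def field_simps)
  then have "exp (- \<alpha> * T) < exp (- ln (C / v x))" by simp
  also have "\<dots> = v x / C" using vx Cpos by (simp add: exp_minus exp_ln)
  finally have zpos: "0 < z x T" by (simp add: z_def)
  obtain u where sol: "heat_solution G (\<lambda>_. 0) u"
    and lim: "\<And>x t. x \<in> verts G \<Longrightarrow> 0 \<le> t \<Longrightarrow> (\<lambda>k. heat_iter G k x t) \<longlonglongrightarrow> u x t"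
    and bd: "\<And>x t. x \<in> verts G \<Longrightarrow> 0 \<le> t \<Longrightarrow> \<bar>u x t\<bar> \<le> 1"
    using heat_limit_exists by (metis abs_of_nonneg)
  have vC: "v y / C \<le> 1" "0 \<le> v y / C" if "y \<in> verts G" for y
    using C[OF that] v0[OF that] Cpos by auto
  have "z x T \<le> heat_iter G k x T" for k
  proof (rule subsolution_le_heat_iter[where T = T
        and z' = "\<lambda>y t. \<alpha> * exp (\<alpha> * (t - T)) / C * v y"])
    fix y assume y: "y \<in> verts G"
    show "continuous_on {0..T} (z y)"
      unfolding z_def by (intro continuous_intros) (use Cpos in auto)
    have "z y 0 = exp (- \<alpha> * T) * (v y / C - 1)" by (simp add: z_def algebra_simps)
    then show "z y 0 \<le> 0" using vC[OF y] by (simp add: mult_le_0_iff)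
  next
    fix y t assume y: "y \<in> verts G" and t: "0 \<le> t" "t \<le> T"
    have "exp (\<alpha> * (t - T)) * (v y / C) \<le> 1 * 1"
      using vC[OF y] t \<alpha> by (intro mult_mono) (auto simp: mult_le_0_iff)
    moreover have "z y t = exp (\<alpha> * (t - T)) * (v y / C) - exp (- \<alpha> * T)"
      by (simp add: z_def)
    ultimately show "z y t \<le> 1"
      using exp_ge_zero[of "- \<alpha> * T"] by linarith
  next
    fix y t assume y: "y \<in> verts G" and t: "0 < t" "t < T"
    show "(z y has_real_derivative \<alpha> * exp (\<alpha> * (t - T)) / C * v y) (at t)"
      unfolding z_def using Cpos by (auto intro!: derivative_eq_intros)
    let ?e = "exp (\<alpha> * (t - T)) / C"
    have "inflow G (\<lambda>y. z y t) y = ?e * inflow G v y - inflow G (\<lambda>_. exp (- \<alpha> * T)) y"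
      using inflow_diff[of G "\<lambda>y. ?e * v y" "\<lambda>_. exp (- \<alpha> * T)" y] inflow_cmult[of G ?e v y]
      by (simp add: z_def)
    then have "laplacian G (\<lambda>y. z y t) y = ?e * laplacian G v y
        - (decay_rate G y * exp (- \<alpha> * T) - inflow G (\<lambda>_. exp (- \<alpha> * T)) y)"
      unfolding laplacian_eq by (simp add: z_def right_diff_distrib)
    also have "\<dots> \<le> ?e * laplacian G v y"
      using inflow_const_le[OF y, of "exp (- \<alpha> * T)"] by simp
    also have "\<dots> \<le> ?e * (- \<alpha> * v y)"
      using sub[OF y] Cpos by (intro mult_left_mono) simp_all
    finally show "\<alpha> * exp (\<alpha> * (t - T)) / C * v y + laplacian G (\<lambda>y. z y t) y \<le> 0"
      by (simp add: mult_ac)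
  qed (use x T0 in auto)
  then have "z x T \<le> u x T" by (intro LIMSEQ_le_const[OF lim[OF x T0]]) auto
  then have "u x T \<noteq> 0" using zpos by simp
  with sol bd x T0 show ?thesis unfolding stochastically_incomplete_def
    by (intro exI[of _ u] conjI exI[of _ 1] bexI[of _ x] exI[of _ T]) auto
qed

section \<open>Spheres and radial functions\<close>

lemma adj_rel_sym: "(x, y) \<in> adj_rel G \<Longrightarrow> (y, x) \<in> adj_rel G"
  using edge_weight_sym[of x y] by (auto simp: adj_rel_def nbrs_def)

lemma gdist_path:
  assumes "x \<in> verts G" and "y \<in> verts G"
  shows "(x, y) \<in> adj_rel G ^^ gdist G x y"
proof -
  have "\<exists>n. (x, y) \<in> adj_rel G ^^ n"
    using connected[OF assms] by (simp add: rtrancl_power)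
  then show ?thesis unfolding gdist_def by (rule LeastI_ex)
qed

lemma gdist_le: "(x, y) \<in> adj_rel G ^^ n \<Longrightarrow> gdist G x y \<le> n"
  unfolding gdist_def by (rule Least_le)

lemma gdist_self [simp]: "gdist G x x = 0"
  using gdist_le[of x x 0] by simp

lemma gdist_eq_0_iff: "x \<in> verts G \<Longrightarrow> y \<in> verts G \<Longrightarrow> gdist G x y = 0 \<longleftrightarrow> x = y"
  using gdist_path[of x y] gdist_self[of x] by (metis relpow_0_E)

lemma gdist_nbr_le:
  assumes "x \<in> verts G" "y \<in> nbrs G x" "z \<in> verts G"
  shows "gdist G y z \<le> Suc (gdist G x z)"
proof (rule gdist_le)
  have "(y, x) \<in> adj_rel G" using assms adj_rel_sym[of x y] by (simp add: adj_rel_def)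
  then show "(y, z) \<in> adj_rel G ^^ Suc (gdist G x z)"
    using gdist_path[OF assms(1,3)] by (rule relpow_Suc_I2)
qed

lemma nbrs_sym: "x \<in> verts G \<Longrightarrow> y \<in> nbrs G x \<Longrightarrow> x \<in> nbrs G y"
  using adj_rel_sym[of x y] by (simp add: adj_rel_def)

lemma gdist_nbr_cases:
  assumes "x \<in> verts G" "y \<in> nbrs G x" "z \<in> verts G"
  obtains "gdist G y z = Suc (gdist G x z)" | "gdist G y z = gdist G x z"
    | "Suc (gdist G y z) = gdist G x z"
  using gdist_nbr_le[OF assms] gdist_nbr_le[OF nbrs_in_verts[OF assms(2)] nbrs_sym[OF assms(1,2)] assms(3)]
  by linarith

lemma gsphere_nat: "gsphere G x0 (int n) = {x \<in> verts G. gdist G x x0 = n}"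
  by (simp add: gsphere_def)

lemma gsphere_predecessor:
  assumes x0: "x0 \<in> verts G" and x: "x \<in> gsphere G x0 (int (Suc n))"
  shows "\<exists>y\<in>gsphere G x0 (int n). x \<in> nbrs G y"
proof -
  have xV: "x \<in> verts G" and d: "gdist G x x0 = Suc n" using x by (auto simp: gsphere_def)
  obtain y where xy: "(x, y) \<in> adj_rel G" and y: "(y, x0) \<in> adj_rel G ^^ n"
    using gdist_path[OF xV x0] unfolding d by (metis relpow_Suc_D2)
  have yn: "y \<in> nbrs G x" using xy by (simp add: adj_rel_def)
  have "gdist G y x0 = n"
    using gdist_le[OF y] gdist_nbr_le[OF nbrs_in_verts[OF yn] nbrs_sym[OF xV yn] x0] d by simp
  then show ?thesis using nbrs_in_verts[OF yn] nbrs_sym[OF xV yn] by (auto simp: gsphere_nat)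
qed

lemma finite_gsphere_nat:
  assumes x0: "x0 \<in> verts G"
  shows "finite (gsphere G x0 (int n))"
proof (induction n)
  case 0
  have "gsphere G x0 (int 0) \<subseteq> {x0}" using gdist_eq_0_iff x0 by (auto simp: gsphere_def)
  then show ?case by (rule finite_subset) simp
next
  case (Suc n)
  have "gsphere G x0 (int (Suc n)) \<subseteq> (\<Union>y\<in>gsphere G x0 (int n). nbrs G y)"
    using gsphere_predecessor[OF x0] by blast
  moreover have "finite (\<Union>y\<in>gsphere G x0 (int n). nbrs G y)"
    using Suc locally_finite by (auto simp: gsphere_def)
  ultimately show ?case by (rule finite_subset)
qed

lemma finite_gsphere:
  assumes "x0 \<in> verts G"
  shows "finite (gsphere G x0 r)"
proof (cases "0 \<le> r")
  case True
  then show ?thesis using finite_gsphere_nat[OF assms, of "nat r"] by simp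
next
  case False
  then have "gsphere G x0 r = {}" by (auto simp: gsphere_def)
  then show ?thesis by simp
qed

lemma finite_gball:
  assumes "x0 \<in> verts G"
  shows "finite {x \<in> verts G. gdist G x x0 < n}"
proof -
  have "{x \<in> verts G. gdist G x x0 < n} = (\<Union>k<n. gsphere G x0 (int k))"
    by (auto simp: gsphere_def)
  then show ?thesis using finite_gsphere[OF assms] by simp
qed

text \<open>An empty sphere would make all larger spheres empty as well, and the graph would be a finite
  ball.\<close>

lemma gsphere_nonempty:
  assumes x0: "x0 \<in> verts G"
  shows "gsphere G x0 (int n) \<noteq> {}"
proof
  assume empty: "gsphere G x0 (int n) = {}"
  have none: "gsphere G x0 (int (n + k)) = {}" for k
  proof (induction k)
    case (Suc k)
    then show ?case using gsphere_predecessor[OF x0, of _ "n + k"] by auto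
  qed (use empty in simp)
  have "gdist G x x0 < n" if "x \<in> verts G" for x
  proof (rule ccontr)
    assume "\<not> gdist G x x0 < n"
    then have "gdist G x x0 = n + (gdist G x x0 - n)" by simp
    then have "x \<in> gsphere G x0 (int (n + (gdist G x x0 - n)))"
      using that by (simp only: gsphere_nat mem_Collect_eq)
    with none show False by blast
  qed
  then have "verts G \<subseteq> {x \<in> verts G. gdist G x x0 < n}" by blast
  with finite_gball[OF x0] have "finite (verts G)" by (rule finite_subset[rotated])
  with infinite_verts show False by simp
qed

lemma sum_nbrs_in_sphere:
  assumes x: "x \<in> verts G" and x0: "x0 \<in> verts G"
  shows "(\<Sum>y\<in>nbrs G x. if y \<in> gsphere G x0 r then edge_weight G x y else 0)
       = (\<Sum>y\<in>gsphere G x0 r. edge_weight G x y)"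
proof -
  have "(\<Sum>y\<in>nbrs G x. if y \<in> gsphere G x0 r then edge_weight G x y else 0)
      = (\<Sum>y\<in>nbrs G x \<inter> gsphere G x0 r. edge_weight G x y)"
    using locally_finite[OF x] by (simp add: sum.inter_restrict)
  also have "\<dots> = (\<Sum>y\<in>gsphere G x0 r. edge_weight G x y)"
    using finite_gsphere[OF x0] edge_weight_nonneg[OF x]
    by (intro sum.mono_neutral_left) (force simp: nbrs_def gsphere_def)+
  finally show ?thesis .
qed

text \<open>Edges inside a sphere do not contribute, as a radial function is constant there. At the
  root the difference \<open>\<phi> r - \<phi> (r - 1)\<close> vanishes because \<open>0 - 1 = 0\<close> on the natural numbers,
  in agreement with \<open>S\<^sub>-\<^sub>1 = \<emptyset>\<close>.\<close>

lemma laplacian_radial: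
  assumes x: "x \<in> verts G" and x0: "x0 \<in> verts G" and r: "gdist G x x0 = r"
  shows "laplacian G (\<lambda>y. \<phi> (gdist G y x0)) x =
    kappa_plus G x0 x * (\<phi> r - \<phi> (Suc r)) + kappa_minus G x0 x * (\<phi> r - \<phi> (r - 1))
      + qpot G x * \<phi> r"
proof -
  let ?P = "gsphere G x0 (int r + 1)" and ?M = "gsphere G x0 (int r - 1)"
  have "edge_weight G x y * (\<phi> r - \<phi> (gdist G y x0)) =
      (if y \<in> ?P then edge_weight G x y else 0) * (\<phi> r - \<phi> (Suc r)) +
      (if y \<in> ?M then edge_weight G x y else 0) * (\<phi> r - \<phi> (r - 1))" if y: "y \<in> nbrs G x" for y
    using x y x0
  proof (cases rule: gdist_nbr_cases)
  qed (use r nbrs_in_verts[OF y] in \<open>auto simp: gsphere_def\<close>)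
  then have "(\<Sum>y\<in>nbrs G x. edge_weight G x y * (\<phi> r - \<phi> (gdist G y x0))) =
      (\<Sum>y\<in>?P. edge_weight G x y) * (\<phi> r - \<phi> (Suc r)) +
      (\<Sum>y\<in>?M. edge_weight G x y) * (\<phi> r - \<phi> (r - 1))"
    by (simp add: sum.distrib sum_distrib_right[symmetric] sum_nbrs_in_sphere[OF x x0])
  then show ?thesis
    unfolding laplacian_def kappa_plus_def kappa_minus_def qpot_def r
    by (simp add: add_divide_distrib)
qed

lemma kappa_minus_nonneg:
  assumes "x \<in> verts G"
  shows "0 \<le> kappa_minus G x0 x"
  unfolding kappa_minus_def using meas_pos[OF assms] edge_weight_nonneg[OF assms]
  by (intro mult_nonneg_nonneg sum_nonneg) (auto simp: gsphere_def)

lemma qpot_nonneg: "x \<in> verts G \<Longrightarrow> 0 \<le> qpot G x"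
  using meas_pos[of x] pot_nonneg[of x] by (simp add: qpot_def)

text \<open>Every vertex of the next sphere has a predecessor. The outer curvature of a single vertex may
  well vanish, but in the symmetric case one positive value fixes the value on the whole sphere.\<close>

lemma ex_kappa_plus_pos:
  assumes x0: "x0 \<in> verts G"
  shows "\<exists>x\<in>gsphere G x0 (int n). 0 < kappa_plus G x0 x"
proof -
  obtain y where y: "y \<in> gsphere G x0 (int (Suc n))" using gsphere_nonempty[OF x0] by blast
  obtain x where xs: "x \<in> gsphere G x0 (int n)" and yx: "y \<in> nbrs G x"
    using gsphere_predecessor[OF x0 y] by blast
  have x: "x \<in> verts G" "gdist G x x0 = n" using xs by (auto simp: gsphere_def)
  have "0 < (\<Sum>y\<in>gsphere G x0 (int n + 1). edge_weight G x y)"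
    using y yx edge_weight_nonneg[OF x(1)]
    by (intro sum_pos2[OF finite_gsphere[OF x0], of y]) (auto simp: nbrs_def gsphere_def)
  then have "0 < kappa_plus G x0 x" using meas_pos[OF x(1)] by (simp add: kappa_plus_def x(2))
  with xs show ?thesis by blast
qed

lemma radial_value_eq:
  assumes "radial G x0 f" and "x \<in> gsphere G x0 (int r)"
  shows "radial_value G x0 f r = f x"
  unfolding radial_value_def
proof (rule the_equality)
  show "f x \<in> f ` gsphere G x0 (int r)" using assms(2) by blast
  show "a = f x" if "a \<in> f ` gsphere G x0 (int r)" for a
    using that assms by (auto simp: radial_def gsphere_def)
qed

text \<open>Subtracting a small multiple \<open>\<epsilon> f\<close> of the supersolution from \<open>v\<close> yields a function that is
  negative outside a finite ball, so that a positive value would lead to a positive global maximum.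
  At such a maximum \<open>(L + \<alpha>) g > 0\<close>, whereas \<open>g = v - \<epsilon> f\<close> satisfies \<open>(L + \<alpha>) g \<le> 0\<close>.\<close>

lemma proper_supersolution_imp_no_subsolution:
  assumes \<alpha>: "0 < \<alpha>" and x0: "x0 \<in> verts G"
    and mono: "mono \<phi>" and pos: "\<And>n. 0 < \<phi> n" and unbdd: "\<not> (\<exists>C. \<forall>n. \<phi> n \<le> C)"
    and super: "\<And>x. x \<in> verts G \<Longrightarrow>
      0 \<le> laplacian G (\<lambda>y. \<phi> (gdist G y x0)) x + \<alpha> * \<phi> (gdist G x x0)"
  shows "\<not> bounded_subsolution G \<alpha> v"
proof
  assume "bounded_subsolution G \<alpha> v"
  then obtain x1 C where v0: "\<And>x. x \<in> verts G \<Longrightarrow> 0 \<le> v x" and x1: "x1 \<in> verts G" "v x1 \<noteq> 0"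
    and C: "\<And>x. x \<in> verts G \<Longrightarrow> v x \<le> C"
    and sub: "\<And>x. x \<in> verts G \<Longrightarrow> laplacian G v x + \<alpha> * v x \<le> 0"
    unfolding bounded_subsolution_def by metis
  define f where "f = (\<lambda>x. \<phi> (gdist G x x0))"
  have vx1: "0 < v x1" using v0 x1 by (simp add: less_le)
  \<comment> \<open>Half of the value that makes \<open>v - \<epsilon> f\<close> vanish at \<open>x1\<close>, so it remains positive there.\<close>
  define \<epsilon> where "\<epsilon> = v x1 / (2 * f x1)"
  have f1: "0 < f x1" using pos by (simp add: f_def)
  have \<epsilon>: "0 < \<epsilon>" using vx1 f1 by (simp add: \<epsilon>_def)
  define g where "g = (\<lambda>x. v x - \<epsilon> * f x)"
  have gx1: "0 < g x1" using vx1 f1 by (simp add: g_def \<epsilon>_def)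
  obtain n where n: "C / \<epsilon> < \<phi> n" using unbdd by (meson not_le)
  define B where "B = {x \<in> verts G. gdist G x x0 < n}"
  have outside: "g x < 0" if "x \<in> verts G" "x \<notin> B" for x
  proof -
    have "\<phi> n \<le> f x" using that mono by (simp add: B_def f_def monoD)
    with n have "C / \<epsilon> < f x" by simp
    then have "C < \<epsilon> * f x" using \<epsilon> by (simp add: field_simps)
    then show ?thesis using C[OF that(1)] by (simp add: g_def)
  qed
  have finB: "finite B" unfolding B_def by (rule finite_gball[OF x0])
  have "x1 \<in> B" using outside[OF x1(1)] gx1 by auto
  then obtain p where p: "p \<in> B" "\<And>x. x \<in> B \<Longrightarrow> g x \<le> g p"
    using Max_in[of "g ` B"] Max_ge[of "g ` B"] finB by fastforce
  have pV: "p \<in> verts G" using p(1) by (simp add: B_def)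
  have gp: "0 < g p" using p(2)[OF \<open>x1 \<in> B\<close>] gx1 by simp
  have max: "g x \<le> g p" if "x \<in> verts G" for x
    using p(2)[of x] outside[OF that] gp by (cases "x \<in> B") auto
  have "inflow G g p \<le> inflow G (\<lambda>_. g p) p" by (intro inflow_mono pV max)
  also have "\<dots> \<le> decay_rate G p * g p" using gp by (intro inflow_const_le pV) simp
  finally have "0 < laplacian G g p + \<alpha> * g p"
    using \<alpha> gp by (simp add: laplacian_eq add_nonneg_pos)
  moreover have "laplacian G g p = laplacian G v p - \<epsilon> * laplacian G f p"
    using inflow_diff[of G v "\<lambda>y. \<epsilon> * f y" p] inflow_cmult[of G \<epsilon> f p]
    by (simp add: laplacian_eq g_def right_diff_distrib)
  moreover have "0 \<le> \<epsilon> * (laplacian G f p + \<alpha> * f p)"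
    using super[OF pV] \<epsilon> by (simp add: f_def)
  ultimately show False using sub[OF pV] by (simp add: g_def algebra_simps)
qed

end

section \<open>The radial profile of a weakly spherically symmetric graph\<close>

text \<open>The equation \<open>(L + \<alpha>) f = 0\<close> for \<open>f = \<phi> (d(\<cdot>, o))\<close>, solved for the value on the next
  sphere. At \<open>r = 0\<close> the term with \<open>km\<close> vanishes because of the truncated subtraction, so a single
  clause covers the root.\<close>

fun radial_profile ::
  "(nat \<Rightarrow> real) \<Rightarrow> (nat \<Rightarrow> real) \<Rightarrow> (nat \<Rightarrow> real) \<Rightarrow> real \<Rightarrow> nat \<Rightarrow> real" where
  "radial_profile kp km q \<alpha> 0 = 1"
| "radial_profile kp km q \<alpha> (Suc r) = radial_profile kp km q \<alpha> r +
     (km r * (radial_profile kp km q \<alpha> r - radial_profile kp km q \<alpha> (r - 1))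
       + (q r + \<alpha>) * radial_profile kp km q \<alpha> r) / kp r"

lemma radial_profile_increasing:
  assumes "\<And>r. 0 < kp r" "\<And>r. 0 \<le> km r" "\<And>r. 0 \<le> q r" "0 < \<alpha>"
  shows "0 < radial_profile kp km q \<alpha> r \<and>
         radial_profile kp km q \<alpha> (r - 1) \<le> radial_profile kp km q \<alpha> r"
proof (induction r)
  case (Suc r)
  let ?\<phi> = "radial_profile kp km q \<alpha>"
  have "0 \<le> (km r * (?\<phi> r - ?\<phi> (r - 1)) + (q r + \<alpha>) * ?\<phi> r) / kp r"
    using Suc assms(1)[of r] assms(2)[of r] assms(3)[of r] assms(4)
    by (intro divide_nonneg_pos add_nonneg_nonneg mult_nonneg_nonneg) auto
  with Suc show ?case by simp
qed simp

text \<open>Incompleteness does not involve \<open>\<alpha>\<close>, so the comparison can be carried out for \<open>\<alpha> = 1\<close>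
  alone.\<close>

abbreviation symmetric_profile :: "'w wgraph \<Rightarrow> 'w \<Rightarrow> nat \<Rightarrow> real" where
  "symmetric_profile H y0 \<equiv>
     radial_profile (kappa_plus_sym H y0) (kappa_minus_sym H y0) (qpot_sym H y0) 1"

section \<open>Comparison with a weakly spherically symmetric graph\<close>

locale comparison = weighted_graph G for G :: "'v wgraph" +
  fixes H :: "'w wgraph" and x0 :: 'v and y0 :: 'w
  assumes root: "x0 \<in> verts G" and symmetric: "weakly_spherically_symmetric H y0"
begin

abbreviation \<phi> where "\<phi> \<equiv> symmetric_profile H y0"

interpretation H: weighted_graph H
  using symmetric by (simp add: weakly_spherically_symmetric_def)

lemma sym_values_on_sphere:
  assumes "y \<in> gsphere H y0 (int r)"
  shows "kappa_plus_sym H y0 r = kappa_plus H y0 y"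
    and "kappa_minus_sym H y0 r = kappa_minus H y0 y"
    and "qpot_sym H y0 r = qpot H y"
  using symmetric assms
  by (simp_all add: weakly_spherically_symmetric_def kappa_plus_sym_def kappa_minus_sym_def
      qpot_sym_def H.radial_value_eq)

lemma sym_coefficients:
  "0 < kappa_plus_sym H y0 r" "0 \<le> kappa_minus_sym H y0 r" "0 \<le> qpot_sym H y0 r"
proof -
  have "y0 \<in> verts H" using symmetric by (simp add: weakly_spherically_symmetric_def)
  then obtain y where y: "y \<in> gsphere H y0 (int r)" "0 < kappa_plus H y0 y"
    using H.ex_kappa_plus_pos by blast
  then show "0 < kappa_plus_sym H y0 r" "0 \<le> kappa_minus_sym H y0 r" "0 \<le> qpot_sym H y0 r"
    using sym_values_on_sphere[OF y(1)] H.kappa_minus_nonneg[of y] H.qpot_nonneg[of y]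
    by (auto simp: gsphere_def)
qed

lemma profile_increasing: "0 < \<phi> r \<and> \<phi> (r - 1) \<le> \<phi> r"
  by (rule radial_profile_increasing) (simp_all add: sym_coefficients)

lemmas profile_pos = profile_increasing[THEN conjunct1]
lemmas profile_pred_le = profile_increasing[THEN conjunct2]

lemma profile_le_Suc: "\<phi> r \<le> \<phi> (Suc r)"
  using profile_pred_le[of "Suc r"] by (simp del: radial_profile.simps)

text \<open>Subtracting the recursion of the profile leaves only the differences of the coefficients.
  Each is multiplied by a nonnegative quantity, so the sign of the whole expression is read off from
  the hypotheses on curvature and potential. The factor \<open>1\<close> is the spectral parameter \<open>\<alpha>\<close>.\<close>

lemma laplacian_profile:
  assumes "x \<in> gsphere G x0 (int r)"
  shows "laplacian G (\<lambda>y. \<phi> (gdist G y x0)) x + 1 * \<phi> r =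
    (kappa_plus_sym H y0 r - kappa_plus G x0 x) * (\<phi> (Suc r) - \<phi> r)
    + (kappa_minus G x0 x - kappa_minus_sym H y0 r) * (\<phi> r - \<phi> (r - 1))
    + (qpot G x - qpot_sym H y0 r) * \<phi> r"
proof -
  have x: "x \<in> verts G" "gdist G x x0 = r" using assms by (auto simp: gsphere_def)
  have "kappa_plus_sym H y0 r * (\<phi> (Suc r) - \<phi> r) =
      kappa_minus_sym H y0 r * (\<phi> r - \<phi> (r - 1)) + (qpot_sym H y0 r + 1) * \<phi> r"
    using sym_coefficients(1)[of r] by simp
  then show ?thesis
    unfolding laplacian_radial[OF x(1) root x(2), of \<phi>] by (simp only: algebra_simps)
qed

lemma stronger_growth_imp_incomplete:
  assumes curv: "stronger_curvature_growth G x0 H y0" and pot: "weaker_potential G x0 H y0"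
    and bdd: "\<exists>C. \<forall>r. \<phi> r \<le> C"
  shows "stochastically_incomplete G"
proof -
  have "laplacian G (\<lambda>y. \<phi> (gdist G y x0)) x + 1 * \<phi> (gdist G x x0) \<le> 0"
    if x: "x \<in> verts G" for x
  proof -
    define r where "r = gdist G x x0"
    have xs: "x \<in> gsphere G x0 (int r)" using x by (simp add: gsphere_def r_def)
    have "kappa_plus_sym H y0 r \<le> kappa_plus G x0 x"
      "kappa_minus G x0 x \<le> kappa_minus_sym H y0 r" "qpot G x \<le> qpot_sym H y0 r"
      using curv pot xs by (auto simp: stronger_curvature_growth_def weaker_potential_def)
    then show ?thesis
      unfolding r_def[symmetric] laplacian_profile[OF xs]
      using profile_le_Suc[of r] profile_pred_le[of r] profile_pos[of r]
      by (intro add_nonpos_nonpos mult_nonpos_nonneg) auto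
  qed
  then have "bounded_subsolution G 1 (\<lambda>y. \<phi> (gdist G y x0))"
    unfolding bounded_subsolution_def using bdd profile_pos root
    by (auto simp: less_imp_le less_imp_neq[symmetric] simp del: radial_profile.simps)
  then show ?thesis by (intro subsolution_imp_stochastically_incomplete) auto
qed

lemma weaker_growth_imp_profile_bounded:
  assumes curv: "weaker_curvature_growth G x0 H y0" and pot: "stronger_potential G x0 H y0"
    and inc: "stochastically_incomplete G"
  shows "\<exists>C. \<forall>r. \<phi> r \<le> C"
proof (rule ccontr)
  assume unbdd: "\<not> (\<exists>C. \<forall>r. \<phi> r \<le> C)"
  have super: "0 \<le> laplacian G (\<lambda>y. \<phi> (gdist G y x0)) x + 1 * \<phi> (gdist G x x0)"
    if x: "x \<in> verts G" for x
  proof -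
    define r where "r = gdist G x x0"
    have xs: "x \<in> gsphere G x0 (int r)" using x by (simp add: gsphere_def r_def)
    have "kappa_plus G x0 x \<le> kappa_plus_sym H y0 r"
      "kappa_minus_sym H y0 r \<le> kappa_minus G x0 x" "qpot_sym H y0 r \<le> qpot G x"
      using curv pot xs by (auto simp: weaker_curvature_growth_def stronger_potential_def)
    then show ?thesis
      unfolding r_def[symmetric] laplacian_profile[OF xs]
      using profile_le_Suc[of r] profile_pred_le[of r] profile_pos[of r]
      by (intro add_nonneg_nonneg mult_nonneg_nonneg) auto
  qed
  have "\<not> bounded_subsolution G 1 v" for v
    by (rule proper_supersolution_imp_no_subsolution[where \<phi> = \<phi>])
       (use root super profile_pos unbdd profile_le_Suc in \<open>auto simp: mono_iff_le_Suc simp del: radial_profile.simps\<close>)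
  with stochastically_incomplete_imp_subsolution[OF inc, of 1] show False by simp
qed

end

lemma symmetric_self_comparison:
  assumes "weakly_spherically_symmetric H y0"
  shows "stronger_curvature_growth H y0 H y0" "weaker_curvature_growth H y0 H y0"
    "stronger_potential H y0 H y0" "weaker_potential H y0 H y0"
proof -
  interpret comparison H H y0 y0
    using assms by (auto simp: comparison_def comparison_axioms_def weakly_spherically_symmetric_def)
  show "stronger_curvature_growth H y0 H y0" "weaker_curvature_growth H y0 H y0"
    "stronger_potential H y0 H y0" "weaker_potential H y0 H y0"
    by (simp_all add: stronger_curvature_growth_def weaker_curvature_growth_def
        stronger_potential_def weaker_potential_def sym_values_on_sphere)
qed

lemma symmetric_incomplete_iff_profile_bounded:
  assumes "weakly_spherically_symmetric H y0"
  shows "stochastically_incomplete H \<longleftrightarrow> (\<exists>C. \<forall>r. symmetric_profile H y0 r \<le> C)"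
proof -
  interpret comparison H H y0 y0
    using assms by (auto simp: comparison_def comparison_axioms_def weakly_spherically_symmetric_def)
  show ?thesis
    using stronger_growth_imp_incomplete weaker_growth_imp_profile_bounded
      symmetric_self_comparison[OF assms] by blast
qed

theorem theorem6:
  fixes G :: "'v wgraph" and Gsym :: "'w wgraph" and x0 :: 'v and y0 :: 'w
  assumes "weighted_graph G" and "x0 \<in> verts G"
    and "weakly_spherically_symmetric Gsym y0"
  shows "(stronger_curvature_growth G x0 Gsym y0 \<and> weaker_potential G x0 Gsym y0 \<and>
            stochastically_incomplete Gsym \<longrightarrow> stochastically_incomplete G) \<and>
         (weaker_curvature_growth G x0 Gsym y0 \<and> stronger_potential G x0 Gsym y0 \<and>
            stochastically_complete Gsym \<longrightarrow> stochastically_complete G)"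
proof -
  interpret comparison G Gsym x0 y0
    using assms by (simp add: comparison_def comparison_axioms_def)
  show ?thesis
    unfolding stochastically_complete_def symmetric_incomplete_iff_profile_bounded[OF assms(3)]
    using stronger_growth_imp_incomplete weaker_growth_imp_profile_bounded by blast
qed

end
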